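(* Let $\mu>0$ and let $h:(0,\infty)\to\mathbb{R}$ be a convex, twice differentiable function. For $U\in \mathrm{Sym}^{++}(3)$ put $$T_{\rm Biot}^{\rm NH}(U)=U+\frac{1}{\mu}\,h'(\det U)\,(\det U)\,U^{-1}.$$ (a) If for every $\alpha\in\mathbb{R}$ the equation $T_{\rm Biot}^{\rm NH}(U)=\alpha\,\mathbb{1}$ has a unique radial solution $U=\beta^+\,\mathbb{1}$, $\beta^+>0$, then $$\Big(\sqrt[3]{x}+\tfrac{1}{\mu}h'(x)\sqrt[3]{x^2}\Big)'\ge 0\quad\text{for all }x>0,$$ $$\lim_{x\to 0}\Big(\sqrt[3]{x}+\tfrac{1}{\mu}h'(x)\sqrt[3]{x^2}\Big)=-\infty,\qquad \lim_{x\to\infty}\Big(\sqrt[3]{x}+\tfrac{1}{\mu}h'(x)\sqrt[3]{x^2}\Big)=\infty.$$ (b) If $$\Big(\sqrt[3]{x}+\tfrac{1}{\mu}h'(x)\sqrt[3]{x^2}\Big)'> 0\quad\text{for all }x>0,$$ $$\lim_{x\to 0}\Big(\sqrt[3]{x}+\tfrac{1}{\mu}h'(x)\sqrt[3]{x^2}\Big)=-\infty,\qquad \lim_{x\to\infty}\Big(\sqrt[3]{x}+\tfrac{1}{\mu}h'(x)\sqrt[3]{x^2}\Big)=\infty,$$ then for every $\alpha\in\mathbb{R}$ the equation $T_{\rm Biot}^{\rm NH}(U)=\alpha\,\mathbb{1}$ has a unique radial solution $U=\beta^+\,\mathbb{1}$, $\beta^+>0$.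
   Context: $\mathrm{Sym}^{++}(3)$ is the set of real symmetric positive definite $3\times3$ matrices and $\mathbb{1}$ is the $3\times 3$ identity matrix. $T_{\rm Biot}^{\rm NH}$ is the Biot stress tensor of the (normalized) Neo-Hooke type energy $\frac12\|U\|^2+\frac1\mu h(\det U)$ (Frobenius norm), i.e. its derivative with respect to $U$. A radial solution is a solution of the form $U=\beta^+\mathbb{1}$ with a real number $\beta^+>0$; "unique radial solution" means that there is exactly one such $\beta^+$. The prime denotes differentiation with respect to $x$. *)

theory Defs
  imports "HOL-Analysis.Analysis"
begin

definition Sym_pp :: "(real^3^3) set" where
  "Sym_pp = {U. transpose U = U \<and> (\<forall>x. x \<noteq> 0 \<longrightarrow> x \<bullet> (U *v x) > 0)}"

text \<open>A function on the positive half-line is represented by a total function, of which only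
  the values at positive arguments matter; \<^term>\<open>{0<..}\<close> is open, so \<^term>\<open>deriv h x\<close> at
  \<open>x > 0\<close> depends on those values only.\<close>

definition twice_differentiable_on_pos :: "(real \<Rightarrow> real) \<Rightarrow> bool" where
  "twice_differentiable_on_pos h \<longleftrightarrow>
     (\<forall>x>0. h differentiable (at x)) \<and> (\<forall>x>0. deriv h differentiable (at x))"

text \<open>The derivative with respect to \<open>U\<close> of the energy \<open>1/2 |U|^2 + 1/\<mu> h(det U)\<close> on
  \<^term>\<open>Sym_pp\<close>, where \<open>|U|\<close> is the Frobenius norm.\<close>

definition T_Biot_NH :: "real \<Rightarrow> (real \<Rightarrow> real) \<Rightarrow> real^3^3 \<Rightarrow> real^3^3" where
  "T_Biot_NH \<mu> h U = U + (1 / \<mu> * deriv h (det U) * det U) *\<^sub>R matrix_inv U"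

definition solves_Biot_NH :: "real \<Rightarrow> (real \<Rightarrow> real) \<Rightarrow> real \<Rightarrow> real^3^3 \<Rightarrow> bool" where
  "solves_Biot_NH \<mu> h \<alpha> U \<longleftrightarrow> U \<in> Sym_pp \<and> T_Biot_NH \<mu> h U = \<alpha> *\<^sub>R mat 1"

definition unique_radial_solution :: "real \<Rightarrow> (real \<Rightarrow> real) \<Rightarrow> real \<Rightarrow> bool" where
  "unique_radial_solution \<mu> h \<alpha> \<longleftrightarrow>
     (\<exists>!\<beta>::real. \<beta> > 0 \<and> solves_Biot_NH \<mu> h \<alpha> (\<beta> *\<^sub>R mat 1))"

text \<open>With \<open>x = det (\<beta> 1) = \<beta>^3\<close> this is the factor \<open>\<alpha>\<close> in \<open>T_Biot_NH \<mu> h (\<beta> 1) = \<alpha> 1\<close>.\<close>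

definition radial_stress :: "real \<Rightarrow> (real \<Rightarrow> real) \<Rightarrow> real \<Rightarrow> real" where
  "radial_stress \<mu> h x = root 3 x + 1 / \<mu> * deriv h x * root 3 (x\<^sup>2)"

end

theory Submission
  imports Defs
begin

text \<open>On \<open>U = \<beta> 1\<close> the equation reads \<open>f (\<beta>\<^sup>3) = \<alpha>\<close> with \<open>f\<close> the radial stress, so unique radial
  solvability for all \<open>\<alpha>\<close> means that \<open>f\<close> is a bijection from the positive half-line onto the
  reals. A continuous such bijection is strictly monotone. Convexity of \<open>h\<close> bounds \<open>h'\<close>, hence
  \<open>f\<close>, from above near \<open>0\<close>, which excludes the decreasing case; monotonicity and surjectivity then
  give the sign of \<open>f'\<close> and both limits. Part (b) is the intermediate value theorem.\<close>

section \<open>Multiples of the identity and the reduction to a scalar equation\<close>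

lemma matrix_inv_eqI:
  fixes A :: "'a::semiring_1^'n^'n"
  assumes "A ** B = mat 1" "B ** A = mat 1"
  shows "matrix_inv A = B"
  unfolding matrix_inv_def
\<comment> \<open>\<open>matrix_inv\<close> is a Hilbert choice, so evaluating it at
  \<open>A\<close> needs the uniqueness of a two-sided inverse: C = (B A) C = B (A C) = B.\<close>
proof (rule some_equality)
  fix C
  assume "A ** C = mat 1 \<and> C ** A = mat 1"
  then have "C = (B ** A) ** C" "B ** (A ** C) = B"
    using assms by simp_all
  then show "C = B"
    by (simp add: matrix_mul_assoc)
qed (use assms in simp)

lemma matrix_inv_scaleR_mat_1:
  fixes c :: real
  assumes "c \<noteq> 0"
  shows "matrix_inv (c *\<^sub>R mat 1 :: real^'n^'n) = (1 / c) *\<^sub>R mat 1"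
proof -
  have "(a *\<^sub>R mat 1 :: real^'n^'n) ** (b *\<^sub>R mat 1) = (a * b) *\<^sub>R mat 1" for a b :: real
    by (simp add: matrix_scalar_ac flip: scalar_matrix_assoc)
  with assms show ?thesis
    by (intro matrix_inv_eqI) simp_all
qed

lemma det_scaleR_mat_1:
  fixes c :: real
  shows "det (c *\<^sub>R mat 1 :: real^'n^'n) = c ^ CARD('n)"
  by (subst det_diagonal) (auto simp: mat_def)

lemma scaleR_mat_1_in_Sym_pp:
  assumes "\<beta> > 0"
  shows "\<beta> *\<^sub>R mat 1 \<in> Sym_pp"
proof -
  have "transpose (\<beta> *\<^sub>R mat 1 :: real^3^3) = \<beta> *\<^sub>R mat 1"
    by (simp add: transpose_def mat_def vec_eq_iff)
  moreover have "x \<bullet> ((\<beta> *\<^sub>R mat 1 :: real^3^3) *v x) > 0" if "x \<noteq> 0" for x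
    using that assms by (simp add: scaleR_matrix_vector_assoc[symmetric])
  ultimately show ?thesis
    by (simp add: Sym_pp_def)
qed

text \<open>Here det U = \<beta>^3 and the inverse of U contributes 1/\<beta>, so the second term
  carries \<beta>^3 / \<beta> = \<beta>^2, which is the cube root of x^2 at x = \<beta>^3.\<close>

lemma T_Biot_NH_radial:
  assumes "\<beta> > 0"
  shows "T_Biot_NH \<mu> h (\<beta> *\<^sub>R mat 1) = radial_stress \<mu> h (\<beta> ^ 3) *\<^sub>R mat 1"
proof -
  have "root 3 ((\<beta> ^ 3)\<^sup>2) = \<beta>\<^sup>2"
    using assms by (intro real_root_pos_unique) (simp_all flip: power_mult)
  moreover have "root 3 (\<beta> ^ 3) = \<beta>"
    using assms by (intro real_root_pos_unique) simp_all
  ultimately have "radial_stress \<mu> h (\<beta> ^ 3) = \<beta> + 1 / \<mu> * deriv h (\<beta> ^ 3) * \<beta> ^ 3 * (1 / \<beta>)"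
    using assms by (simp add: radial_stress_def power3_eq_cube power2_eq_square)
  then show ?thesis
    using assms
    by (simp add: T_Biot_NH_def det_scaleR_mat_1 matrix_inv_scaleR_mat_1 scaleR_add_left)
qed

lemma solves_Biot_NH_radial_iff:
  assumes "\<beta> > 0"
  shows "solves_Biot_NH \<mu> h \<alpha> (\<beta> *\<^sub>R mat 1) \<longleftrightarrow> radial_stress \<mu> h (\<beta> ^ 3) = \<alpha>"
proof -
  \<comment> \<open>This allows cancelling \<open>mat 1\<close> from an equation between two of its
    multiples.\<close>
  have "(mat 1 :: real^3^3) \<noteq> 0"
    by (simp add: mat_def vec_eq_iff)
  then show ?thesis
    using assms by (simp add: solves_Biot_NH_def scaleR_mat_1_in_Sym_pp T_Biot_NH_radial)
qed

text \<open>Cubing is a bijection of the positive half-line with inverse \<open>root 3\<close>, so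
  existence and uniqueness transfer between \<beta> and x = \<beta>^3.\<close>

lemma unique_radial_solution_iff:
  "unique_radial_solution \<mu> h \<alpha> \<longleftrightarrow> (\<exists>!x. x > 0 \<and> radial_stress \<mu> h x = \<alpha>)"
proof -
  have eq: "(\<beta> > 0 \<and> solves_Biot_NH \<mu> h \<alpha> (\<beta> *\<^sub>R mat 1)) \<longleftrightarrow>
      (\<beta> > 0 \<and> radial_stress \<mu> h (\<beta> ^ 3) = \<alpha>)" for \<beta>
    using solves_Biot_NH_radial_iff by blast
  have "(\<exists>!\<beta>. \<beta> > 0 \<and> P (\<beta> ^ 3)) \<longleftrightarrow> (\<exists>!x. x > 0 \<and> P x)" for P :: "real \<Rightarrow> bool"
  proof
    assume "\<exists>!\<beta>. \<beta> > 0 \<and> P (\<beta> ^ 3)"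
    then obtain \<beta> where \<beta>: "\<beta> > 0" "P (\<beta> ^ 3)" and uniq: "\<And>c. c > 0 \<Longrightarrow> P (c ^ 3) \<Longrightarrow> c = \<beta>"
      by blast
    show "\<exists>!x. x > 0 \<and> P x"
    proof (rule ex1I[of _ "\<beta> ^ 3"])
      fix x :: real
      assume x: "x > 0 \<and> P x"
      then have "root 3 x ^ 3 = x"
        by simp
      moreover from this x have "root 3 x = \<beta>"
        by (intro uniq) simp_all
      ultimately show "x = \<beta> ^ 3"
        by simp
    qed (use \<beta> in simp)
  next
    assume "\<exists>!x. x > 0 \<and> P x"
    then obtain x where x: "x > 0" "P x" and uniq: "\<And>y. y > 0 \<Longrightarrow> P y \<Longrightarrow> y = x"
      by blast
    show "\<exists>!\<beta>. \<beta> > 0 \<and> P (\<beta> ^ 3)"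
    proof (rule ex1I[of _ "root 3 x"])
      show "\<beta> = root 3 x" if "\<beta> > 0 \<and> P (\<beta> ^ 3)" for \<beta>
        using that uniq[of "\<beta> ^ 3"] by (auto simp: real_root_power_cancel)
    qed (use x in simp)
  qed
  from this[of "\<lambda>x. radial_stress \<mu> h x = \<alpha>"] show ?thesis
    by (simp add: unique_radial_solution_def eq)
qed

section \<open>Regularity of the radial stress and its bound near 0\<close>

lemma radial_stress_differentiable:
  assumes "twice_differentiable_on_pos h" "x > 0"
  shows "radial_stress \<mu> h differentiable at x"
proof -
  obtain D where D: "(deriv h has_real_derivative D) (at x)"
    using assms by (auto simp: twice_differentiable_on_pos_def real_differentiable_def)
  \<comment> \<open>The cube root has a finite derivative only away from 0; x > 0 makes both x and
    x^2 admissible arguments.\<close>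
  have root: "(root 3 has_real_derivative inverse (real 3 * root 3 y ^ (3 - Suc 0))) (at y)"
    if "y > 0" for y
    using that by (intro DERIV_real_root) simp_all
  have "((\<lambda>x. root 3 (x\<^sup>2)) has_real_derivative
      inverse (real 3 * root 3 (x\<^sup>2) ^ (3 - Suc 0)) * (2 * x)) (at x)"
    using assms by (intro DERIV_chain'[OF _ root]) (auto intro!: derivative_eq_intros)
  with root[OF assms(2)] D show ?thesis
    unfolding radial_stress_def [abs_def]
    by (intro differentiable_add differentiable_mult differentiable_const)
       (auto simp: real_differentiable_def)
qed

text \<open>A convex function lies above its tangents. The tangents at \<open>x\<close> and at
  \<open>y\<close> enclose h(y) - h(x) between h'(x)(y - x) and h'(y)(y - x).\<close>

lemma convex_on_deriv_mono:
  fixes h :: "real \<Rightarrow> real"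
  assumes convex: "convex_on S h" and S: "open S" "connected S" "x \<in> S" "y \<in> S"
    and diff: "h differentiable at x" "h differentiable at y" and "x \<le> y"
  shows "deriv h x \<le> deriv h y"
proof (cases "x = y")
  case False
  have tangent: "h b - h a \<ge> deriv h a * (b - a)"
    if "a \<in> S" "b \<in> S" "h differentiable at a" for a b
    using that S interior_open[of S]
    by (intro convex_on_imp_above_tangent[OF convex])
       (auto intro: has_field_derivative_at_within simp: DERIV_deriv_iff_real_differentiable)
  have "deriv h x * (y - x) \<le> h y - h x" "deriv h y * (x - y) \<le> h x - h y"
    using S diff by (auto intro!: tangent)
  then have "deriv h x * (y - x) \<le> deriv h y * (y - x)"
    by (simp add: algebra_simps)
  with False assms show ?thesis
    by simp
qed simp

text \<open>On (0, 1] both roots lie in [0, 1], and h' is at most h'(1) by monotonicity. The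
  absolute value makes the bound nonnegative, so that a factor at most 1 cannot increase it.\<close>

lemma radial_stress_bounded_near_0:
  assumes "\<mu> > 0" "convex_on {0<..} h" "twice_differentiable_on_pos h" "0 < x" "x \<le> 1"
  shows "radial_stress \<mu> h x \<le> 1 + \<bar>deriv h 1\<bar> / \<mu>"
proof -
  have root: "root 3 x \<le> 1" "0 \<le> root 3 (x\<^sup>2)" "root 3 (x\<^sup>2) \<le> 1"
    using assms by (simp_all add: power_le_one)
  have "deriv h x \<le> deriv h 1"
    using assms
    by (intro convex_on_deriv_mono[where S = "{0<..}"]) (auto simp: twice_differentiable_on_pos_def)
  then have "1 / \<mu> * deriv h x \<le> \<bar>deriv h 1\<bar> / \<mu>"
    using assms by (simp add: divide_right_mono)
  then have "1 / \<mu> * deriv h x * root 3 (x\<^sup>2) \<le> \<bar>deriv h 1\<bar> / \<mu> * root 3 (x\<^sup>2)"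
    using root by (intro mult_right_mono)
  also have "\<dots> \<le> \<bar>deriv h 1\<bar> / \<mu>"
    using root assms by (intro mult_left_le) auto
  finally show ?thesis
    using root unfolding radial_stress_def by linarith
qed

section \<open>Real functions on an open half-line: monotonicity, limits, preimages\<close>

lemma strict_mono_on_pos_if_bounded_near_0:
  fixes f :: "real \<Rightarrow> real"
  assumes cont: "continuous_on {0<..} f" and bij: "\<And>\<alpha>. \<exists>!x. x > 0 \<and> f x = \<alpha>"
    and bounded: "\<And>x. 0 < x \<Longrightarrow> x \<le> 1 \<Longrightarrow> f x \<le> C"
  shows "strict_mono_on {0<..} f"
proof -
  have "inj_on f {0<..}"
    using bij by (fastforce intro: inj_onI)
  then consider "strict_mono_on {0<..} f" | "strict_antimono_on {0<..} f"
    using injective_eq_monotone_map[OF _ cont] by (auto simp: is_interval_oi)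
  then show ?thesis
  proof cases
    case 2
    \<comment> \<open>A decreasing \<open>f\<close> would exceed C + 1 everywhere to the left of
      \<open>y\<close>. The point \<open>min 1 (y / 2)\<close> is to the left of \<open>y\<close>
      and also in (0, 1], where C is an upper bound.\<close>
    obtain y where y: "y > 0" "f y = C + 1"
      using bij by blast
    have "f (min 1 (y / 2)) > f y"
      using y by (intro monotone_onD[OF 2]) auto
    moreover have "f (min 1 (y / 2)) \<le> C"
      using y by (intro bounded) auto
    ultimately show ?thesis
      using y by simp
  qed
qed

text \<open>A preimage of the level \<open>Z\<close> is a threshold: by monotonicity all values to
  its left are at most \<open>Z\<close>.\<close>

lemma filterlim_at_bot_at_right_if_strict_mono_on:
  fixes f :: "real \<Rightarrow> real"
  assumes "strict_mono_on {a<..} f" "\<And>\<alpha>. \<exists>x>a. f x = \<alpha>"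
  shows "filterlim f at_bot (at_right a)"
  unfolding filterlim_at_bot
proof
  fix Z
  obtain x where x: "x > a" "f x = Z"
    using assms by blast
  then have "f y \<le> Z" if "a < y" "y < x" for y
    using that strict_mono_onD[OF assms(1), of y x] by simp
  with x show "eventually (\<lambda>y. f y \<le> Z) (at_right a)"
    unfolding eventually_at_right_field by blast
qed

lemma filterlim_at_top_at_top_if_strict_mono_on:
  fixes f :: "real \<Rightarrow> real"
  assumes "strict_mono_on {a<..} f" "\<And>\<alpha>. \<exists>x>a. f x = \<alpha>"
  shows "filterlim f at_top at_top"
  unfolding filterlim_at_top
proof
  fix Z
  obtain x where x: "x > a" "f x = Z"
    using assms by blast
  then have "f y \<ge> Z" if "y > x" for y
    using that strict_mono_onD[OF assms(1), of x y] by simp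
  then show "eventually (\<lambda>y. f y \<ge> Z) at_top"
    unfolding eventually_at_top_dense by blast
qed

text \<open>The positive derivative makes \<open>f\<close> strictly increasing, hence injective; the
  limits supply points with values on either side of \<alpha> for the intermediate value
  theorem.\<close>

lemma ex1_preimage_if_deriv_pos:
  fixes f :: "real \<Rightarrow> real"
  assumes diff: "\<And>x. x > a \<Longrightarrow> f differentiable at x"
    and pos: "\<And>x. x > a \<Longrightarrow> deriv f x > 0"
    and bot: "filterlim f at_bot (at_right a)" and top: "filterlim f at_top at_top"
  shows "\<exists>!x. x > a \<and> f x = \<alpha>"
proof -
  have less: "f x < f y" if "a < x" "x < y" for x y
  proof (rule DERIV_pos_imp_increasing[where f = f])
    show "\<exists>D. (f has_real_derivative D) (at z) \<and> D > 0" if "x \<le> z" for z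
      using that \<open>a < x\<close> diff[of z] pos[of z]
      by (intro exI[of _ "deriv f z"]) (simp add: DERIV_deriv_iff_real_differentiable)
  qed (use that in simp)
  have "eventually (\<lambda>x. f x \<le> \<alpha>) (at_right a)"
    using bot by (simp add: filterlim_at_bot)
  then obtain b where b: "b > a" "\<And>y. a < y \<Longrightarrow> y < b \<Longrightarrow> f y \<le> \<alpha>"
    unfolding eventually_at_right_field by blast
  \<comment> \<open>The bound holds only strictly between \<open>a\<close> and \<open>b\<close>, so
    the midpoint is taken.\<close>
  define l where "l = (a + b) / 2"
  have l: "a < l" "f l \<le> \<alpha>"
    using b by (auto simp: l_def)
  \<comment> \<open>Requiring x \<ge> l as well orders the endpoints for the intermediate value
    theorem.\<close>
  have "eventually (\<lambda>x. f x \<ge> \<alpha> \<and> x \<ge> l) at_top"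
    using top by (intro eventually_conj eventually_ge_at_top) (simp add: filterlim_at_top)
  then obtain u where u: "f u \<ge> \<alpha>" "u \<ge> l"
    by (auto simp: eventually_at_top_linorder)
  have "continuous_on {l..u} f"
    using diff l
    by (intro continuous_at_imp_continuous_on ballI differentiable_imp_continuous_within) auto
  with IVT'[of f l \<alpha> u] l u obtain x where "l \<le> x" "f x = \<alpha>"
    by blast
  with l have x: "x > a" "f x = \<alpha>"
    by simp_all
  moreover have "y = x" if "y > a" "f y = \<alpha>" for y
    using that x less[of x y] less[of y x] by (cases x y rule: linorder_cases) simp_all
  ultimately show ?thesis
    by blast
qed

theorem proposition5p1:
  fixes \<mu> :: real and h :: "real \<Rightarrow> real"
  assumes "\<mu> > 0"
    and "convex_on {0<..} h"
    and "twice_differentiable_on_pos h"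
  shows "((\<forall>\<alpha>::real. unique_radial_solution \<mu> h \<alpha>) \<longrightarrow>
            (\<forall>x>0. deriv (radial_stress \<mu> h) x \<ge> 0) \<and>
            filterlim (radial_stress \<mu> h) at_bot (at_right 0) \<and>
            filterlim (radial_stress \<mu> h) at_top at_top) \<and>
         ((\<forall>x>0. deriv (radial_stress \<mu> h) x > 0) \<and>
            filterlim (radial_stress \<mu> h) at_bot (at_right 0) \<and>
            filterlim (radial_stress \<mu> h) at_top at_top \<longrightarrow>
          (\<forall>\<alpha>::real. unique_radial_solution \<mu> h \<alpha>))"
proof (intro conjI impI)
  let ?f = "radial_stress \<mu> h"
  have diff: "?f differentiable at x" if "x > 0" for x
    using that assms by (intro radial_stress_differentiable)
  {
    assume "\<forall>\<alpha>. unique_radial_solution \<mu> h \<alpha>"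
    then have bij: "\<exists>!x. x > 0 \<and> ?f x = \<alpha>" for \<alpha>
      by (simp add: unique_radial_solution_iff)
    then have surj: "\<exists>x>0. ?f x = \<alpha>" for \<alpha>
      by blast
    have "continuous_on {0<..} ?f"
      using diff
      by (intro continuous_at_imp_continuous_on ballI differentiable_imp_continuous_within) auto
    then have mono: "strict_mono_on {0<..} ?f"
      using bij radial_stress_bounded_near_0[OF assms]
      by (rule strict_mono_on_pos_if_bounded_near_0)
    show "\<forall>x>0. deriv ?f x \<ge> 0"
    proof (intro allI impI)
      fix x :: real
      assume x: "x > 0"
      then have "(?f has_real_derivative deriv ?f x) (at x)"
        using diff by (simp add: DERIV_deriv_iff_real_differentiable)
      then show "deriv ?f x \<ge> 0"
        \<comment> \<open>Strict monotonicity gives only a nonnegative derivative, as x^3 at 0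
          shows.\<close>
        using x strict_mono_on_imp_mono_on[OF mono]
        by (intro mono_on_imp_deriv_nonneg[where A = "{0<..}"]) (auto simp: interior_open)
    qed
    show "filterlim ?f at_bot (at_right 0)"
      using mono surj by (rule filterlim_at_bot_at_right_if_strict_mono_on)
    show "filterlim ?f at_top at_top"
      using mono surj by (rule filterlim_at_top_at_top_if_strict_mono_on)
  }
  assume "(\<forall>x>0. deriv ?f x > 0) \<and> filterlim ?f at_bot (at_right 0) \<and> filterlim ?f at_top at_top"
  then show "\<forall>\<alpha>. unique_radial_solution \<mu> h \<alpha>"
    unfolding unique_radial_solution_iff using diff
    by (intro allI ex1_preimage_if_deriv_pos) auto
qed

end
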